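(* Let $(V,V^+)$ be an ordered $*$-vector space with order unit $e$, and assume $V\neq\{0\}$. Then any two order seminorms on $V$ are equivalent. Moreover, if $|||\cdot|||$ is any order seminorm on $V$, then $$\{v \in V: |||v|||=0 \} = \bigcap_{f} \ker f,$$ where the intersection is over all states $f:V\to\mathbb{C}$.
   Context: A $*$-vector space is a complex vector space $V$ with a conjugate-linear involution $*:V\to V$; $V_h:=\{x\in V: x^*=x\}$. An ordered $*$-vector space $(V,V^+)$ is a $*$-vector space $V$ with a nonempty subset $V^+\subseteq V_h$ closed under addition and under multiplication by scalars in $[0,\infty)$, such that $V^+\cap -V^+=\{0\}$. For $v,w\in V_h$ write $v\ge w$ if $v-w\in V^+$. An element $e\in V_h$ is an order unit if for every $x\in V_h$ there is a real $r>0$ with $re\ge x$. A state on $V$ is a $\mathbb{C}$-linear functional $f:V\to\mathbb{C}$ with $f(V^+)\subseteq[0,\infty)$ and $f(e)=1$. The order seminorm on $V_h$ is $\|v\|:=\inf\{r\in\mathbb{R}: re+v\ge0\text{ and }re-v\ge0\}$. An order seminorm on $V$ is a complex seminorm $|||\cdot|||$ on $V$ such that $|||v^*|||=|||v|||$ for all $v\in V$ and $|||v|||=\|v\|$ for all $v\in V_h$. Two seminorms $p,p'$ are equivalent if there are constants $c,C>0$ with $c\,p\le p'\le C\,p$. *)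

theory Defs
  imports "HOL-Analysis.Analysis"
begin

text \<open>
  The vector space is the whole type \<open>'a\<close>, with complex scalar multiplication \<open>scale\<close>.
\<close>

locale star_vector_space = vector_space scale
  for scale :: "complex \<Rightarrow> 'a::ab_group_add \<Rightarrow> 'a" +
  fixes star :: "'a \<Rightarrow> 'a"
  assumes star_add: "star (x + y) = star x + star y"
    and star_scale: "star (scale c x) = scale (cnj c) (star x)"
    and star_star: "star (star x) = x"
begin

definition hermitian :: "'a set" where
  "hermitian = {x. star x = x}"

end

locale ordered_star_vector_space = star_vector_space scale star
  for scale :: "complex \<Rightarrow> 'a::ab_group_add \<Rightarrow> 'a"
    and star :: "'a \<Rightarrow> 'a" +
  fixes Pos :: "'a set"
  assumes Pos_nonempty: "Pos \<noteq> {}"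
    and Pos_hermitian: "Pos \<subseteq> hermitian"
    and Pos_add: "x \<in> Pos \<Longrightarrow> y \<in> Pos \<Longrightarrow> x + y \<in> Pos"
    and Pos_scale: "0 \<le> r \<Longrightarrow> x \<in> Pos \<Longrightarrow> scale (complex_of_real r) x \<in> Pos"
    and Pos_proper: "Pos \<inter> uminus ` Pos = {0}"
begin

text \<open>\<open>geq v w\<close> is only meaningful for hermitian \<open>v\<close> and \<open>w\<close>.\<close>

definition geq :: "'a \<Rightarrow> 'a \<Rightarrow> bool" where
  "geq v w \<longleftrightarrow> v - w \<in> Pos"

definition order_unit :: "'a \<Rightarrow> bool" where
  "order_unit e \<longleftrightarrow>
     e \<in> hermitian \<and> (\<forall>x\<in>hermitian. \<exists>r>0. geq (scale (complex_of_real r) e) x)"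

definition state :: "'a \<Rightarrow> ('a \<Rightarrow> complex) \<Rightarrow> bool" where
  "state e f \<longleftrightarrow>
     Vector_Spaces.linear scale (*) f \<and> f ` Pos \<subseteq> \<real>\<^sub>\<ge>\<^sub>0 \<and> f e = 1"

text \<open>
  On hermitian elements of a nonzero space with order unit \<open>e\<close>, the set below is nonempty and
  bounded below by \<open>0\<close>, so the infimum is the genuine one.
\<close>

definition order_norm :: "'a \<Rightarrow> 'a \<Rightarrow> real" where
  "order_norm e v = Inf {r::real. geq (scale (complex_of_real r) e + v) 0 \<and>
                                  geq (scale (complex_of_real r) e - v) 0}"

definition seminorm :: "('a \<Rightarrow> real) \<Rightarrow> bool" where
  "seminorm p \<longleftrightarrow>
     (\<forall>v. 0 \<le> p v) \<and>
     (\<forall>c v. p (scale c v) = cmod c * p v) \<and>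
     (\<forall>v w. p (v + w) \<le> p v + p w)"

definition order_seminorm :: "'a \<Rightarrow> ('a \<Rightarrow> real) \<Rightarrow> bool" where
  "order_seminorm e p \<longleftrightarrow>
     seminorm p \<and> (\<forall>v. p (star v) = p v) \<and> (\<forall>v\<in>hermitian. p v = order_norm e v)"

end

definition equivalent_seminorms :: "('a \<Rightarrow> real) \<Rightarrow> ('a \<Rightarrow> real) \<Rightarrow> bool" where
  "equivalent_seminorms p p' \<longleftrightarrow>
     (\<exists>c>0. \<exists>C>0. \<forall>v. c * p v \<le> p' v \<and> p' v \<le> C * p v)"

end

theory Submission
  imports Defs
begin

text \<open>
  Every \<open>v\<close> is \<open>a + \<i> b\<close> with hermitian \<open>a\<close> and \<open>b\<close>. For an order seminorm \<open>p\<close>, invariance under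
  the involution gives \<open>p a \<le> p v\<close> and \<open>p b \<le> p v\<close>, while \<open>p v \<le> p a + p b\<close>. As \<open>p a\<close> and \<open>p b\<close>
  are determined by the order, any two order seminorms differ at most by a factor \<open>2\<close>, and
  \<open>p v = 0\<close> if and only if \<open>a\<close> and \<open>b\<close> have order norm \<open>0\<close>.

  A state \<open>f\<close> is real on hermitian elements and bounded there by the order norm, so it vanishes at
  \<open>v\<close> whenever \<open>p v = 0\<close>; and \<open>f v = 0\<close> forces \<open>f a = f b = 0\<close>. It remains to see that a hermitian
  \<open>a\<close> at which all states vanish has order norm \<open>0\<close>. The least \<open>r\<close> with \<open>r e \<ge> a\<close> (as an infimum)
  is a sublinear function \<open>q\<close> of \<open>a\<close>, and the real linear functionals below \<open>q\<close> are the
  restrictions of states. By the Hahn--Banach theorem some state takes the value \<open>q a\<close> at \<open>a\<close>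
  (lemma \<open>state_attaining_upper_bound\<close>). Hence \<open>q a = q (- a) = 0\<close>, which says that the order norm
  of \<open>a\<close> is \<open>0\<close>.

  The Hahn--Banach theorem is needed for a sublinear function on a real vector space without
  topology. It is obtained from Zorn's lemma applied to sublinear functions below \<open>q\<close>, ordered
  pointwise: a minimal one is linear.
\<close>

section \<open>The Hahn--Banach theorem for sublinear functions\<close>

text \<open>
  Real vector spaces with an explicit scalar multiplication, so that a complex vector space can be
  regarded as a real one by restricting the scalars.
\<close>

locale real_scaling = vector_space scaleR'
  for scaleR' :: "real \<Rightarrow> 'a::ab_group_add \<Rightarrow> 'a"
begin

text \<open>
  Subadditive and positively homogeneous functions. Homogeneity is only required as an inequality;
  equality follows for positive scalars by scaling back, and for \<open>0\<close> by subadditivity.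
\<close>

definition sublinear :: "('a \<Rightarrow> real) \<Rightarrow> bool" where
  "sublinear q \<longleftrightarrow>
     (\<forall>x y. q (x + y) \<le> q x + q y) \<and> (\<forall>t x. 0 \<le> t \<longrightarrow> q (scaleR' t x) \<le> t * q x)"

lemma sublinearI:
  assumes "\<And>x y. q (x + y) \<le> q x + q y"
    and "q 0 \<le> 0"
    and "\<And>t x. 0 < t \<Longrightarrow> q (scaleR' t x) \<le> t * q x"
  shows "sublinear q"
  unfolding sublinear_def
proof (intro conjI allI impI)
  show "q (scaleR' t x) \<le> t * q x" if "0 \<le> t" for t x
    using assms(2,3) that by (cases "t = 0") auto
qed (rule assms(1))

lemma sublinear_add: "sublinear q \<Longrightarrow> q (x + y) \<le> q x + q y"
  by (simp add: sublinear_def)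

lemma sublinear_zero:
  assumes "sublinear q"
  shows "q 0 = 0"
proof -
  have "q (scaleR' 0 0) \<le> 0 * q 0" using assms unfolding sublinear_def by blast
  moreover have "q (0 + 0) \<le> q 0 + q 0" using assms by (rule sublinear_add)
  ultimately show ?thesis by simp
qed

lemma sublinear_scale:
  assumes "sublinear q" "0 \<le> t"
  shows "q (scaleR' t x) = t * q x"
proof (cases "t = 0")
  case False
  then have t: "0 < t" using assms(2) by simp
  have "q (scaleR' (1 / t) (scaleR' t x)) \<le> 1 / t * q (scaleR' t x)"
    using assms(1) t unfolding sublinear_def by (meson divide_nonneg_nonneg less_imp_le zero_le_one)
  then have "t * q x \<le> q (scaleR' t x)"
    using t by (simp add: field_simps)
  moreover have "q (scaleR' t x) \<le> t * q x"
    using assms unfolding sublinear_def by blast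
  ultimately show ?thesis by simp
qed (simp add: sublinear_zero[OF assms(1)])

lemma sublinear_minus:
  assumes "sublinear q"
  shows "- q (- x) \<le> q x"
  using sublinear_add[OF assms, of x "- x"] sublinear_zero[OF assms] by simp

lemma sublinear_chain_infimum:
  assumes "sublinear q" "C \<noteq> {}"
    and C: "\<And>g. g \<in> C \<Longrightarrow> sublinear g \<and> g \<le> q"
    and chain: "\<And>g h. g \<in> C \<Longrightarrow> h \<in> C \<Longrightarrow> g \<le> h \<or> h \<le> g"
  shows "\<exists>m. sublinear m \<and> (\<forall>g\<in>C. m \<le> g)"
proof -
  define m where "m = (\<lambda>x. INF g\<in>C. g x)"
  have bdd: "bdd_below ((\<lambda>g. g x) ` C)" for x
  proof (rule bdd_belowI2)
    fix g assume "g \<in> C"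
    then have "sublinear g" "g (- x) \<le> q (- x)" using C by (auto simp: le_fun_def)
    then show "- q (- x) \<le> g x" using sublinear_minus[of g x] by linarith
  qed
  have lower: "m x \<le> g x" if "g \<in> C" for g x
    unfolding m_def using bdd that by (rule cINF_lower)
  have greatest: "c \<le> m x" if "\<And>g. g \<in> C \<Longrightarrow> c \<le> g x" for c x
    unfolding m_def using \<open>C \<noteq> {}\<close> that by (rule cINF_greatest)
  have "sublinear m"
  proof (rule sublinearI)
    fix x y
    have two: "m (x + y) \<le> g x + h y" if g: "g \<in> C" and h: "h \<in> C" for g h
    proof -
      obtain k where k: "k \<in> C" "k \<le> g" "k \<le> h" using chain[OF g h] g h by blast
      have "m (x + y) \<le> k (x + y)" by (rule lower[OF k(1)])
      also have "\<dots> \<le> k x + k y" using C[OF k(1)] sublinear_add by blast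
      also have "\<dots> \<le> g x + h y" using k(2,3) by (intro add_mono) (auto simp: le_fun_def)
      finally show ?thesis .
    qed
    have "m (x + y) - g x \<le> m y" if "g \<in> C" for g
      using two[OF that] by (intro greatest) (simp add: algebra_simps)
    then have "m (x + y) - m y \<le> m x"
      by (intro greatest) (simp add: algebra_simps)
    then show "m (x + y) \<le> m x + m y" by simp
  next
    obtain g where "g \<in> C" using \<open>C \<noteq> {}\<close> by blast
    then show "m 0 \<le> 0" using lower[of g 0] C sublinear_zero[of g] by simp
  next
    fix t :: real and x assume t: "0 < t"
    have "m (scaleR' t x) / t \<le> m x"
    proof (rule greatest)
      fix g assume g: "g \<in> C"
      then have "m (scaleR' t x) \<le> t * g x"
        using lower[OF g, of "scaleR' t x"] C sublinear_scale[of g t x] t by simp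
      then show "m (scaleR' t x) / t \<le> g x" using t by (simp add: field_simps)
    qed
    then show "m (scaleR' t x) \<le> t * m x" using t by (simp add: field_simps)
  qed
  then show ?thesis using lower by (auto simp: le_fun_def)
qed

text \<open>
  A sublinear function can be lowered so as to become odd at a given point: a minimal sublinear
  function is therefore odd, and the first lowering may be used to prescribe a value.
\<close>

lemma sublinear_lower_at:
  assumes "sublinear q"
  shows "\<exists>g. sublinear g \<and> g \<le> q \<and> g (- x) \<le> - q x"
proof -
  \<comment> \<open>the largest sublinear function below \<open>q\<close> whose value at \<open>- x\<close> is at most \<open>- q x\<close>\<close>
  define g where "g = (\<lambda>y. INF t\<in>{0..}. q (y + scaleR' t x) - t * q x)"
  have bdd: "bdd_below ((\<lambda>t. q (y + scaleR' t x) - t * q x) ` {0..})" for y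
  proof (rule bdd_belowI2)
    fix t :: real assume "t \<in> {0..}"
    then have "t * q x = q ((y + scaleR' t x) + (- y))"
      using sublinear_scale[OF assms] by simp
    also have "\<dots> \<le> q (y + scaleR' t x) + q (- y)"
      by (rule sublinear_add[OF assms])
    finally show "- q (- y) \<le> q (y + scaleR' t x) - t * q x" by simp
  qed
  have lower: "g y \<le> q (y + scaleR' t x) - t * q x" if "0 \<le> t" for t y
    unfolding g_def using bdd that by (intro cINF_lower) auto
  have greatest: "c \<le> g y" if "\<And>t. 0 \<le> t \<Longrightarrow> c \<le> q (y + scaleR' t x) - t * q x" for c y
    unfolding g_def using that by (intro cINF_greatest) auto
  have "sublinear g"
  proof (rule sublinearI)
    fix y z
    have two: "g (y + z) \<le> (q (y + scaleR' t x) - t * q x) + (q (z + scaleR' u x) - u * q x)"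
      if "0 \<le> t" "0 \<le> u" for t u
    proof -
      have "g (y + z) \<le> q ((y + z) + scaleR' (t + u) x) - (t + u) * q x"
        using that by (intro lower) simp
      also have "(y + z) + scaleR' (t + u) x = (y + scaleR' t x) + (z + scaleR' u x)"
        by (simp add: scale_left_distrib)
      also have "q \<dots> \<le> q (y + scaleR' t x) + q (z + scaleR' u x)"
        by (rule sublinear_add[OF assms])
      finally show ?thesis by (simp add: algebra_simps)
    qed
    have "g (y + z) - (q (y + scaleR' t x) - t * q x) \<le> g z" if "0 \<le> t" for t
      using two[OF that] by (intro greatest) (simp add: algebra_simps)
    then have "g (y + z) - g z \<le> g y"
      by (intro greatest) (simp add: algebra_simps)
    then show "g (y + z) \<le> g y + g z" by simp
  next
    show "g 0 \<le> 0" using lower[of 0 0] sublinear_zero[OF assms] by simp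
  next
    fix k :: real and y assume k: "0 < k"
    have "g (scaleR' k y) / k \<le> g y"
    proof (rule greatest)
      fix t :: real assume t: "0 \<le> t"
      have "g (scaleR' k y) \<le> q (scaleR' k y + scaleR' (k * t) x) - (k * t) * q x"
        using k t by (intro lower) simp
      also have "scaleR' k y + scaleR' (k * t) x = scaleR' k (y + scaleR' t x)"
        by (simp add: scale_right_distrib)
      also have "q \<dots> = k * q (y + scaleR' t x)"
        using sublinear_scale[OF assms] k by simp
      finally show "g (scaleR' k y) / k \<le> q (y + scaleR' t x) - t * q x"
        using k by (simp add: field_simps)
    qed
    then show "g (scaleR' k y) \<le> k * g y" using k by (simp add: field_simps)
  qed
  moreover have "g \<le> q" using lower[of 0] by (simp add: le_fun_def)
  moreover have "g (- x) \<le> - q x"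
    using lower[of 1 "- x"] sublinear_zero[OF assms] by simp
  ultimately show ?thesis by blast
qed

theorem hahn_banach_sublinear:
  assumes q: "sublinear q"
  shows "\<exists>f. (\<forall>x y. f (x + y) = f x + f y) \<and> (\<forall>t x. f (scaleR' t x) = t * f x) \<and>
             (\<forall>x. f x \<le> q x) \<and> f x0 = q x0"
proof -
  obtain q0 where q0: "sublinear q0" "q0 \<le> q" "q0 (- x0) \<le> - q x0"
    using sublinear_lower_at[OF q] by blast
  define A where "A = {g. sublinear g \<and> g \<le> q0}"
  have "\<exists>f\<in>A. \<forall>g\<in>A. f \<ge> g \<longrightarrow> g = f"
  proof (rule predicate_Zorn)
    show "partial_order_on A (relation_of (\<ge>) A)"
      by (rule partial_order_on_relation_ofI) auto
    fix C assume C: "C \<in> Chains (relation_of (\<ge>) A)"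
    have CA: "C \<subseteq> A" using Chains_relation_of[OF C] .
    show "\<exists>u\<in>A. \<forall>a\<in>C. a \<ge> u"
    proof (cases "C = {}")
      case True
      then show ?thesis using q0(1) by (auto simp: A_def)
    next
      case False
      have chain: "g \<le> h \<or> h \<le> g" if "g \<in> C" "h \<in> C" for g h
        using C that by (auto simp: Chains_def relation_of_def)
      obtain m where m: "sublinear m" "\<forall>g\<in>C. m \<le> g"
        using sublinear_chain_infimum[OF q0(1) False _ chain] CA by (auto simp: A_def)
      moreover have "m \<le> q0" using m(2) False CA by (force simp: A_def)
      ultimately show ?thesis by (auto simp: A_def)
    qed
  qed
  then obtain f where "f \<in> A" and "\<And>g. g \<in> A \<Longrightarrow> g \<le> f \<Longrightarrow> g = f" by blast
  then have f: "sublinear f" "f \<le> q0"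
    and minimal: "\<And>g. sublinear g \<Longrightarrow> g \<le> f \<Longrightarrow> g = f"
    unfolding A_def using order_trans[of _ f q0] by blast+
  have odd: "f (- x) = - f x" for x
  proof -
    obtain g where g: "sublinear g" "g \<le> f" "g (- x) \<le> - f x"
      using sublinear_lower_at[OF f(1)] by blast
    then show ?thesis using minimal[OF g(1,2)] sublinear_minus[OF f(1), of x] by simp
  qed
  have add: "f (x + y) = f x + f y" for x y
    using sublinear_add[OF f(1), of x y] sublinear_add[OF f(1), of "- x" "- y"] odd[of x] odd[of y]
      odd[of "x + y"] by simp
  have scale: "f (scaleR' t x) = t * f x" for t x
  proof (cases "0 \<le> t")
    case True
    then show ?thesis by (rule sublinear_scale[OF f(1)])
  next
    case False
    then show ?thesis
      using sublinear_scale[OF f(1), of "- t" x] odd[of "scaleR' t x"] by simp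
  qed
  have le: "f x \<le> q x" for x
    using f(2) q0(2) by (meson le_funD order_trans)
  have "f (- x0) \<le> - q x0"
    using f(2) q0(3) by (meson le_funD order_trans)
  then have "f x0 = q x0" using odd[of x0] le[of x0] by simp
  then show ?thesis using add scale le by blast
qed

end


section \<open>Real and imaginary parts\<close>

context star_vector_space
begin

text \<open>The hermitian part \<open>(v + v\<^sup>*) / 2\<close>. The imaginary part of \<open>v\<close> is \<open>re_part (- \<i> v)\<close>.\<close>

definition re_part :: "'a \<Rightarrow> 'a" where
  "re_part v = scale (1 / 2) (v + star v)"

lemma star_minus: "star (- x) = - star x"
  using star_scale[of "- 1" x] by simp

lemma scale_half_double: "scale (1 / 2) (x + x) = x"
proof -
  have "scale (1 / 2) (x + x) = scale (1 / 2 + 1 / 2) x"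
    by (simp only: scale_right_distrib scale_left_distrib)
  then show ?thesis by simp
qed

lemma re_part_hermitian: "re_part v \<in> hermitian"
  by (simp add: re_part_def hermitian_def star_scale star_add star_star add.commute)

lemma re_part_of_hermitian: "v \<in> hermitian \<Longrightarrow> re_part v = v"
  by (simp add: re_part_def hermitian_def scale_half_double del: scale_right_distrib)

lemma re_part_add: "re_part (x + y) = re_part x + re_part y"
  unfolding re_part_def star_add scale_right_distrib by (simp add: algebra_simps)

lemma re_part_scale: "re_part (scale (complex_of_real r) x) = scale (complex_of_real r) (re_part x)"
  unfolding re_part_def star_scale
  by (simp add: scale_right_distrib mult.commute)

lemma re_part_zero: "re_part 0 = 0"
  using re_part_scale[of 0 0] by simp

lemma re_part_imaginary:
  assumes "v \<in> hermitian"
  shows "re_part (scale \<i> v) = 0"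
  using assms by (simp add: re_part_def hermitian_def star_scale)

lemma re_im_decomposition: "v = re_part v + scale \<i> (re_part (scale (- \<i>) v))"
proof -
  have "scale \<i> (re_part (scale (- \<i>) v)) = scale (1 / 2) (v - star v)"
    by (simp add: re_part_def star_scale star_minus scale_right_distrib scale_right_diff_distrib)
  then have "re_part v + scale \<i> (re_part (scale (- \<i>) v)) = scale (1 / 2) (v + v)"
    by (simp only: re_part_def scale_right_distrib[symmetric]) simp
  then show ?thesis by (simp only: scale_half_double)
qed

lemma hermitian_zero: "0 \<in> hermitian"
  using re_part_hermitian[of 0] by (simp add: re_part_zero)

lemma hermitian_minus: "v \<in> hermitian \<Longrightarrow> - v \<in> hermitian"
  by (simp add: hermitian_def star_minus)

lemma real_scaling: "real_scaling (\<lambda>r. scale (complex_of_real r))"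
  by unfold_locales (simp_all add: scale_right_distrib scale_left_distrib)

end


section \<open>Order seminorms\<close>

context ordered_star_vector_space
begin

lemma order_seminorm_re_part:
  assumes "order_seminorm e p"
  shows "p (re_part v) \<le> p v" "p (re_part (scale (- \<i>) v)) \<le> p v"
proof -
  have p: "\<And>c v. p (scale c v) = cmod c * p v" "\<And>v w. p (v + w) \<le> p v + p w"
    "\<And>v. p (star v) = p v"
    using assms by (simp_all add: order_seminorm_def seminorm_def)
  have le: "p (re_part w) \<le> p w" for w
    using p(2)[of w "star w"] p(3)[of w] by (simp add: re_part_def p(1) del: scale_right_distrib)
  show "p (re_part v) \<le> p v" by (rule le)
  show "p (re_part (scale (- \<i>) v)) \<le> p v"
    using le[of "scale (- \<i>) v"] by (simp add: p(1) del: scale_minus_left)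
qed

lemma order_seminorm_le_parts:
  assumes "order_seminorm e p"
  shows "p v \<le> p (re_part v) + p (re_part (scale (- \<i>) v))"
proof -
  have "p v = p (re_part v + scale \<i> (re_part (scale (- \<i>) v)))"
    using re_im_decomposition[of v] by simp
  also have "\<dots> \<le> p (re_part v) + p (scale \<i> (re_part (scale (- \<i>) v)))"
    using assms unfolding order_seminorm_def seminorm_def by blast
  also have "p (scale \<i> w) = p w" for w
    using assms by (simp add: order_seminorm_def seminorm_def)
  finally show ?thesis .
qed

lemma order_seminorm_le_twice:
  assumes "order_seminorm e p" "order_seminorm e p'"
  shows "p v \<le> 2 * p' v"
proof -
  have "p w = p' w" if "w \<in> hermitian" for w
    using assms that by (simp add: order_seminorm_def)
  then have "p v \<le> p' (re_part v) + p' (re_part (scale (- \<i>) v))"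
    using order_seminorm_le_parts[OF assms(1), of v] re_part_hermitian by metis
  then show ?thesis
    using order_seminorm_re_part[OF assms(2), of v] by linarith
qed

lemma order_seminorms_equivalent:
  assumes "order_seminorm e p" "order_seminorm e p'"
  shows "equivalent_seminorms p p'"
  unfolding equivalent_seminorms_def
proof (intro exI conjI allI)
  show "(1 / 2) * p v \<le> p' v" for v
    using order_seminorm_le_twice[OF assms, of v] by simp
  show "p' v \<le> 2 * p v" for v
    using order_seminorm_le_twice[OF assms(2,1)] .
qed simp_all

lemma order_seminorm_eq_0_iff:
  assumes "order_seminorm e p"
  shows "p v = 0 \<longleftrightarrow>
    order_norm e (re_part v) = 0 \<and> order_norm e (re_part (scale (- \<i>) v)) = 0"
proof -
  have "p w = order_norm e w" if "w \<in> hermitian" for w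
    using assms that by (simp add: order_seminorm_def)
  then have eq: "order_norm e (re_part w) = p (re_part w)" for w
    using re_part_hermitian by simp
  have nonneg: "0 \<le> p w" for w
    using assms by (simp add: order_seminorm_def seminorm_def)
  show ?thesis
    unfolding eq
    using order_seminorm_le_parts[OF assms, of v] order_seminorm_re_part[OF assms, of v]
      nonneg[of v] nonneg[of "re_part v"] nonneg[of "re_part (scale (- \<i>) v)"] by linarith
qed

lemma zero_Pos: "0 \<in> Pos"
  using Pos_proper by blast

end


section \<open>States and the order unit\<close>

text \<open>
  Nonzero ordered \<open>*\<close>-vector spaces with an order unit \<open>e\<close>. Nontriviality ensures \<open>e \<noteq> 0\<close>, so that
  \<open>r e\<close> is positive only for \<open>r \<ge> 0\<close> and the infima below are taken over sets bounded below.
\<close>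

locale order_unit_space = ordered_star_vector_space scale star Pos
  for scale :: "complex \<Rightarrow> 'a::ab_group_add \<Rightarrow> 'a"
    and star :: "'a \<Rightarrow> 'a"
    and Pos :: "'a set" +
  fixes e :: 'a
  assumes order_unit: "order_unit e"
    and nontrivial: "(UNIV :: 'a set) \<noteq> {0}"
begin

abbreviation unit_multiple :: "real \<Rightarrow> 'a" where
  "unit_multiple r \<equiv> scale (complex_of_real r) e"

lemma order_unit_bound:
  assumes "x \<in> hermitian"
  obtains r where "0 < r" "unit_multiple r - x \<in> Pos"
  using order_unit assms unfolding order_unit_def geq_def by blast

lemma e_Pos: "e \<in> Pos"
proof -
  obtain r where r: "0 < r" "unit_multiple r - 0 \<in> Pos"
    using order_unit_bound[OF hermitian_zero] .
  have "scale (complex_of_real (1 / r)) (unit_multiple r) \<in> Pos"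
    using r by (simp only: Pos_scale diff_zero zero_le_divide_1_iff less_imp_le)
  moreover have "complex_of_real (1 / r) * complex_of_real r = 1"
    using r(1) by simp
  ultimately show ?thesis by (simp only: scale_scale scale_one)
qed

lemma e_nonzero: "e \<noteq> 0"
proof
  assume "e = 0"
  have zero: "x = 0" if "x \<in> hermitian" for x
  proof -
    have "- x \<in> Pos" "x \<in> Pos"
      using order_unit_bound[OF that] order_unit_bound[OF hermitian_minus[OF that]] \<open>e = 0\<close>
      by auto
    then have "x \<in> Pos \<inter> uminus ` Pos" by force
    then show ?thesis using Pos_proper by simp
  qed
  have "v = 0" for v :: 'a
    using re_im_decomposition[of v] zero[OF re_part_hermitian] by simp
  then show False using nontrivial by auto
qed

lemma unit_multiple_Pos_iff: "unit_multiple r \<in> Pos \<longleftrightarrow> 0 \<le> r"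
proof
  assume r: "unit_multiple r \<in> Pos"
  show "0 \<le> r"
  proof (rule ccontr)
    assume "\<not> 0 \<le> r"
    then have "scale (complex_of_real (- 1 / r)) (unit_multiple r) \<in> Pos"
      using \<open>\<not> 0 \<le> r\<close> by (intro Pos_scale[OF _ r]) (simp add: field_simps)
    moreover have "complex_of_real (- 1 / r) * complex_of_real r = - 1"
      using \<open>\<not> 0 \<le> r\<close> by simp
    ultimately have "scale (- 1) e \<in> Pos" by (simp only: scale_scale)
    then have "- e \<in> Pos" by simp
    then have "e \<in> Pos \<inter> uminus ` Pos" using e_Pos by force
    then show False using Pos_proper e_nonzero by simp
  qed
qed (rule Pos_scale[OF _ e_Pos])

lemma unit_multiple_add: "unit_multiple (r + s) = unit_multiple r + unit_multiple s"
  by (simp add: scale_left_distrib)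

lemma Pos_unit_multiple_mono:
  assumes "unit_multiple r + x \<in> Pos" "r \<le> s"
  shows "unit_multiple s + x \<in> Pos"
proof -
  have "(unit_multiple r + x) + unit_multiple (s - r) \<in> Pos"
    using assms(2) by (intro Pos_add[OF assms(1)]) (simp only: unit_multiple_Pos_iff diff_ge_0_iff_ge)
  moreover have "(unit_multiple r + x) + unit_multiple (s - r) = unit_multiple s + x"
    using unit_multiple_add[of r "s - r"] by (simp add: algebra_simps)
  ultimately show ?thesis by (simp only:)
qed

lemma order_norm_nonempty:
  assumes "a \<in> hermitian"
  shows "\<exists>r. unit_multiple r + a \<in> Pos \<and> unit_multiple r - a \<in> Pos"
proof -
  obtain r s where "unit_multiple r - a \<in> Pos" "unit_multiple s - (- a) \<in> Pos"
    using order_unit_bound[OF assms] order_unit_bound[OF hermitian_minus[OF assms]] by metis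
  then show ?thesis
    using Pos_unit_multiple_mono[of r "- a" "max r s"] Pos_unit_multiple_mono[of s a "max r s"]
    by (intro exI[of _ "max r s"]) simp
qed

lemma order_norm_le:
  assumes "unit_multiple r + a \<in> Pos" "unit_multiple r - a \<in> Pos"
  shows "order_norm e a \<le> r"
proof -
  have "0 \<le> s" if "unit_multiple s + a \<in> Pos" "unit_multiple s - a \<in> Pos" for s
  proof -
    have "unit_multiple (s + s) \<in> Pos"
      using Pos_add[OF that] unit_multiple_add[of s s] by simp
    then show ?thesis unfolding unit_multiple_Pos_iff by simp
  qed
  then show ?thesis
    unfolding order_norm_def geq_def using assms
    by (intro cInf_lower bdd_belowI[of _ 0]) auto
qed

lemma stateD:
  assumes "state e f"
  shows "f (x + y) = f x + f y" "f (x - y) = f x - f y" "f (scale c x) = c * f x"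
    "x \<in> Pos \<Longrightarrow> f x \<in> \<real>\<^sub>\<ge>\<^sub>0" "f e = 1"
proof -
  have "Vector_Spaces.linear scale (*) f" using assms by (simp add: state_def)
  then interpret f: Vector_Spaces.linear scale "(*)" f .
  show "f (x + y) = f x + f y" "f (x - y) = f x - f y" "f (scale c x) = c * f x"
    by (rule f.add f.diff f.scale)+
  show "x \<in> Pos \<Longrightarrow> f x \<in> \<real>\<^sub>\<ge>\<^sub>0" "f e = 1" using assms by (auto simp: state_def)
qed

lemma state_hermitian:
  assumes f: "state e f" and a: "a \<in> hermitian"
  shows "f a \<in> \<real>" "cmod (f a) \<le> order_norm e a"
proof -
  have bound: "f a \<in> \<real> \<and> cmod (f a) \<le> r"
    if "unit_multiple r + a \<in> Pos" "unit_multiple r - a \<in> Pos" for r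
  proof -
    have "complex_of_real r + f a \<in> \<real>\<^sub>\<ge>\<^sub>0" "complex_of_real r - f a \<in> \<real>\<^sub>\<ge>\<^sub>0"
      using stateD(4)[OF f that(1)] stateD(4)[OF f that(2)] by (simp_all add: stateD[OF f])
    then show ?thesis
      by (auto simp: complex_nonneg_Reals_iff complex_is_Real_iff cmod_eq_Re)
  qed
  obtain r where "unit_multiple r + a \<in> Pos" "unit_multiple r - a \<in> Pos"
    using order_norm_nonempty[OF a] by blast
  then show "f a \<in> \<real>" using bound by blast
  show "cmod (f a) \<le> order_norm e a"
    unfolding order_norm_def geq_def using order_norm_nonempty[OF a] bound
    by (intro cInf_greatest) auto
qed

text \<open>
  A complex linear functional that is real on hermitian elements vanishes at \<open>v\<close> exactly if it
  vanishes at the real and imaginary parts of \<open>v\<close>.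
\<close>

lemma state_eq_0_iff:
  assumes f: "state e f"
  shows "f v = 0 \<longleftrightarrow> f (re_part v) = 0 \<and> f (re_part (scale (- \<i>) v)) = 0"
proof -
  have "f v = f (re_part v + scale \<i> (re_part (scale (- \<i>) v)))"
    using re_im_decomposition[of v] by simp
  also have "\<dots> = f (re_part v) + \<i> * f (re_part (scale (- \<i>) v))"
    by (simp only: stateD[OF f])
  finally show ?thesis
    using state_hermitian(1)[OF f re_part_hermitian, of v]
      state_hermitian(1)[OF f re_part_hermitian, of "scale (- \<i>) v"]
    by (auto simp: complex_eq_iff complex_is_Real_iff)
qed

text \<open>
  The least \<open>r\<close> with \<open>r e \<ge> re_part v\<close>, as an infimum. Passing to the real part makes the function
  total, so that the Hahn--Banach theorem applies to the whole space, viewed as a real one.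
\<close>

definition upper_bound :: "'a \<Rightarrow> real" where
  "upper_bound v = Inf {r. unit_multiple r - re_part v \<in> Pos}"

lemma upper_bound_nonempty: "{r. unit_multiple r - re_part v \<in> Pos} \<noteq> {}"
  using order_unit_bound[OF re_part_hermitian] by blast

lemma upper_bound_le:
  assumes "unit_multiple r - re_part v \<in> Pos"
  shows "upper_bound v \<le> r"
proof -
  obtain s where s: "unit_multiple s - (- re_part v) \<in> Pos"
    using order_unit_bound[OF hermitian_minus[OF re_part_hermitian]] .
  have "- s \<le> t" if "unit_multiple t - re_part v \<in> Pos" for t
  proof -
    have "unit_multiple (t + s) \<in> Pos"
      using Pos_add[OF that s] unit_multiple_add[of t s] by simp
    then show ?thesis unfolding unit_multiple_Pos_iff by simp
  qed
  then show ?thesis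
    unfolding upper_bound_def using assms by (intro cInf_lower bdd_belowI[of _ "- s"]) auto
qed

lemma upper_bound_greatest:
  assumes "\<And>r. unit_multiple r - re_part v \<in> Pos \<Longrightarrow> c \<le> r"
  shows "c \<le> upper_bound v"
  unfolding upper_bound_def using upper_bound_nonempty assms by (intro cInf_greatest) auto

lemma upper_bound_less:
  assumes "upper_bound v < r"
  shows "unit_multiple r - re_part v \<in> Pos"
proof -
  obtain s where "unit_multiple s - re_part v \<in> Pos" "s < r"
    using assms upper_bound_greatest[of v r] by force
  then show ?thesis using Pos_unit_multiple_mono[of s "- re_part v" r] by simp
qed

lemma upper_bound_sublinear:
  "real_scaling.sublinear (\<lambda>r. scale (complex_of_real r)) upper_bound"
proof -
  interpret R: real_scaling "\<lambda>r. scale (complex_of_real r)" by (rule real_scaling)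
  show ?thesis
  proof (rule R.sublinearI)
    fix x y
    have two: "upper_bound (x + y) \<le> r + s"
      if "unit_multiple r - re_part x \<in> Pos" "unit_multiple s - re_part y \<in> Pos" for r s
      using Pos_add[OF that] unit_multiple_add[of r s]
      by (intro upper_bound_le) (simp add: re_part_add algebra_simps)
    have "upper_bound (x + y) - r \<le> upper_bound y" if "unit_multiple r - re_part x \<in> Pos" for r
      using two[OF that] by (intro upper_bound_greatest) (simp add: algebra_simps)
    then have "upper_bound (x + y) - upper_bound y \<le> upper_bound x"
      by (intro upper_bound_greatest) (simp add: algebra_simps)
    then show "upper_bound (x + y) \<le> upper_bound x + upper_bound y" by simp
  next
    show "upper_bound 0 \<le> 0"
      by (rule upper_bound_le) (simp add: re_part_zero zero_Pos)
  next
    fix t :: real and x assume t: "0 < t"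
    have "upper_bound (scale (complex_of_real t) x) / t \<le> upper_bound x"
    proof (rule upper_bound_greatest)
      fix r assume "unit_multiple r - re_part x \<in> Pos"
      then have "scale (complex_of_real t) (unit_multiple r - re_part x) \<in> Pos"
        using t by (intro Pos_scale) simp_all
      then have "upper_bound (scale (complex_of_real t) x) \<le> t * r"
        by (intro upper_bound_le) (simp add: re_part_scale scale_right_diff_distrib)
      then show "upper_bound (scale (complex_of_real t) x) / t \<le> r"
        using t by (simp add: field_simps)
    qed
    then show "upper_bound (scale (complex_of_real t) x) \<le> t * upper_bound x"
      using t by (simp add: field_simps)
  qed
qed

lemma state_attaining_upper_bound:
  assumes a: "a \<in> hermitian"
  obtains f where "state e f" "f a = complex_of_real (upper_bound a)"
proof -
  interpret R: real_scaling "\<lambda>r. scale (complex_of_real r)" by (rule real_scaling)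
  obtain g where add: "\<And>x y. g (x + y) = g x + g y"
    and scale: "\<And>t x. g (scale (complex_of_real t) x) = t * g x"
    and le: "\<And>x. g x \<le> upper_bound x" and ga: "g a = upper_bound a"
    using R.hahn_banach_sublinear[OF upper_bound_sublinear, of a] by blast
  have minus: "g (- x) = - g x" for x using scale[of "- 1" x] by simp
  \<comment> \<open>\<open>g\<close> vanishes on \<open>\<i> b\<close> for hermitian \<open>b\<close>, since \<open>upper_bound\<close> only sees real parts\<close>
  have imag: "g (scale \<i> b) = 0" if "b \<in> hermitian" for b
  proof -
    have nonpos: "g (scale \<i> c) \<le> 0" if "c \<in> hermitian" for c
    proof -
      have "upper_bound (scale \<i> c) \<le> 0"
        by (rule upper_bound_le) (simp add: re_part_imaginary[OF that] zero_Pos)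
      then show ?thesis using le[of "scale \<i> c"] by linarith
    qed
    show ?thesis
      using nonpos[OF that] nonpos[OF hermitian_minus[OF that]] minus[of "scale \<i> b"] by simp
  qed
  \<comment> \<open>the complex linear functional with real part \<open>g\<close>\<close>
  define f where "f = (\<lambda>v. Complex (g v) (- g (scale \<i> v)))"
  have f_hermitian: "f b = complex_of_real (g b)" if "b \<in> hermitian" for b
    by (simp add: f_def imag[OF that] complex_eq_iff)
  have f_add: "f (x + y) = f x + f y" for x y
    by (simp add: f_def add scale_right_distrib complex_eq_iff)
  have f_scale: "f (scale c x) = c * f x" for c x
  proof -
    have g_scale: "g (scale d y) = Re d * g y + Im d * g (scale \<i> y)" for d y
    proof -
      have "scale d y = scale (complex_of_real (Re d) + complex_of_real (Im d) * \<i>) y"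
        by (simp add: complex_eq_iff)
      also have "\<dots> = scale (complex_of_real (Re d)) y
          + scale (complex_of_real (Im d)) (scale \<i> y)"
        by (simp only: scale_left_distrib scale_scale)
      finally show ?thesis by (simp only: add scale)
    qed
    show ?thesis
      using g_scale[of c x] g_scale[of "\<i> * c" x]
      by (simp add: f_def complex_eq_iff)
  qed
  have "Vector_Spaces.linear scale (*) f"
    by unfold_locales (simp_all add: f_add f_scale algebra_simps)
  moreover have "f x \<in> \<real>\<^sub>\<ge>\<^sub>0" if x: "x \<in> Pos" for x
  proof -
    have h: "x \<in> hermitian" using x Pos_hermitian by blast
    have "upper_bound (- x) \<le> 0"
      by (rule upper_bound_le) (simp add: re_part_of_hermitian[OF hermitian_minus[OF h]] x)
    then have "0 \<le> g x" using le[of "- x"] minus[of x] by linarith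
    then show ?thesis by (simp add: f_hermitian[OF h])
  qed
  moreover have "f e = 1"
  proof -
    have h: "e \<in> hermitian" using e_Pos Pos_hermitian by blast
    have "upper_bound e \<le> 1"
      by (rule upper_bound_le) (simp add: re_part_of_hermitian[OF h] zero_Pos)
    moreover have "upper_bound (- e) \<le> - 1"
      by (rule upper_bound_le) (simp add: re_part_of_hermitian[OF hermitian_minus[OF h]] zero_Pos)
    ultimately have "g e = 1" using le[of e] le[of "- e"] minus[of e] by linarith
    then show ?thesis by (simp add: f_hermitian[OF h])
  qed
  ultimately have "state e f" by (auto simp: state_def)
  moreover have "f a = complex_of_real (upper_bound a)" by (simp add: f_hermitian[OF a] ga)
  ultimately show ?thesis using that by blast
qed

lemma order_norm_le_0:
  assumes a: "a \<in> hermitian" and vanish: "\<And>f. state e f \<Longrightarrow> f a = 0"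
  shows "order_norm e a \<le> 0"
proof (rule field_le_epsilon)
  fix r :: real assume r: "0 < r"
  have a': "- a \<in> hermitian" by (rule hermitian_minus[OF a])
  obtain f where f: "state e f" "f a = complex_of_real (upper_bound a)"
    using state_attaining_upper_bound[OF a] .
  obtain g where g: "state e g" "g (- a) = complex_of_real (upper_bound (- a))"
    using state_attaining_upper_bound[OF a'] .
  have "g (- a) = 0" using stateD(3)[OF g(1), of "- 1" a] vanish[OF g(1)] by simp
  then have "upper_bound a < r" "upper_bound (- a) < r"
    using f(2) vanish[OF f(1)] g(2) r by simp_all
  then have "unit_multiple r - a \<in> Pos" "unit_multiple r + a \<in> Pos"
    using upper_bound_less[of a r] upper_bound_less[of "- a" r]
    by (simp_all add: re_part_of_hermitian[OF a] re_part_of_hermitian[OF a'])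
  then show "order_norm e a \<le> 0 + r" by (simp add: order_norm_le)
qed

lemma order_norm_eq_0_iff:
  assumes a: "a \<in> hermitian" and p: "order_seminorm e p"
  shows "order_norm e a = 0 \<longleftrightarrow> (\<forall>f. state e f \<longrightarrow> f a = 0)"
proof
  show "\<forall>f. state e f \<longrightarrow> f a = 0" if "order_norm e a = 0"
    using state_hermitian(2)[OF _ a] that by fastforce
  have "0 \<le> order_norm e a"
    using p a unfolding order_seminorm_def seminorm_def by metis
  then show "order_norm e a = 0" if "\<forall>f. state e f \<longrightarrow> f a = 0"
    using order_norm_le_0[OF a] that by force
qed

lemma order_seminorm_kernel:
  assumes "order_seminorm e p"
  shows "{v. p v = 0} = (\<Inter>f\<in>{f. state e f}. {v. f v = 0})"
proof -
  have "p v = 0 \<longleftrightarrow> (\<forall>f. state e f \<longrightarrow> f v = 0)" for v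
    unfolding order_seminorm_eq_0_iff[OF assms]
      order_norm_eq_0_iff[OF re_part_hermitian assms]
    using state_eq_0_iff by blast
  then show ?thesis by auto
qed

end

theorem proposition4p9:
  fixes scale :: "complex \<Rightarrow> 'a::ab_group_add \<Rightarrow> 'a"
    and star :: "'a \<Rightarrow> 'a"
    and Pos :: "'a set"
    and e :: 'a
  assumes "ordered_star_vector_space scale star Pos"
    and "ordered_star_vector_space.order_unit scale star Pos e"
    and "(UNIV :: 'a set) \<noteq> {0}"
  shows "(\<forall>p p'. ordered_star_vector_space.order_seminorm scale star Pos e p \<longrightarrow>
                 ordered_star_vector_space.order_seminorm scale star Pos e p' \<longrightarrow>
                 equivalent_seminorms p p') \<and>
         (\<forall>p. ordered_star_vector_space.order_seminorm scale star Pos e p \<longrightarrow>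
              {v. p v = 0} =
              (\<Inter>f \<in> {f. ordered_star_vector_space.state scale Pos e f}. {v. f v = 0}))"
proof -
  interpret order_unit_space scale star Pos e
    using assms by (simp add: order_unit_space_def order_unit_space_axioms_def)
  show ?thesis
    using order_seminorms_equivalent order_seminorm_kernel by blast
qed

end
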